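(* The variety $\mathsf{CIdInRL}$ is not locally finite.
   Context: A commutative idempotent involutive residuated lattice is an algebra $\mathbf{A}=\langle A,\wedge,\vee,\cdot,\to,1,0\rangle$ such that $\langle A,\wedge,\vee\rangle$ is a lattice (with lattice order $\leq$), $\langle A,\cdot,1\rangle$ is a commutative monoid with $x\cdot x=x$ for all $x$, residuation holds ($x\cdot y\leq z \iff y\leq x\to z$), and, writing $-x := x\to 0$, one has $-{-}x=x$ for all $x$. The class of these algebras, which is a variety, is $\mathsf{CIdInRL}$. A variety is locally finite if each of its finitely generated members is finite. *)

theory Defs
  imports "HOL-Algebra.Group"
begin

record 'a rl_algebra = "'a monoid" +
  rl_meet :: "'a \<Rightarrow> 'a \<Rightarrow> 'a" (infixl "\<curlywedge>\<index>" 70)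
  rl_join :: "'a \<Rightarrow> 'a \<Rightarrow> 'a" (infixl "\<curlyvee>\<index>" 65)
  rl_imp  :: "'a \<Rightarrow> 'a \<Rightarrow> 'a" (infixr "\<leadsto>\<index>" 60)
  rl_zero :: 'a ("\<zero>\<index>")

definition rl_le :: "('a, 'b) rl_algebra_scheme \<Rightarrow> 'a \<Rightarrow> 'a \<Rightarrow> bool" (infix "\<preceq>\<index>" 50)
  where "x \<preceq>\<^bsub>A\<^esub> y \<longleftrightarrow> x \<curlywedge>\<^bsub>A\<^esub> y = x"

definition rl_neg :: "('a, 'b) rl_algebra_scheme \<Rightarrow> 'a \<Rightarrow> 'a" ("\<sim>\<index> _" [81] 80)
  where "\<sim>\<^bsub>A\<^esub> x = x \<leadsto>\<^bsub>A\<^esub> \<zero>\<^bsub>A\<^esub>"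

text \<open>
  The lattice reduct is axiomatised by the usual lattice identities. The constant 0 is an arbitrary
  element; neither 0 nor 1 is assumed to be a bound of the lattice.
\<close>

locale cidinrl = comm_monoid A for A (structure) +
  assumes meet_closed: "\<lbrakk>x \<in> carrier A; y \<in> carrier A\<rbrakk> \<Longrightarrow> x \<curlywedge> y \<in> carrier A"
    and join_closed: "\<lbrakk>x \<in> carrier A; y \<in> carrier A\<rbrakk> \<Longrightarrow> x \<curlyvee> y \<in> carrier A"
    and imp_closed: "\<lbrakk>x \<in> carrier A; y \<in> carrier A\<rbrakk> \<Longrightarrow> x \<leadsto> y \<in> carrier A"
    and zero_closed: "\<zero> \<in> carrier A"
    and meet_comm: "\<lbrakk>x \<in> carrier A; y \<in> carrier A\<rbrakk> \<Longrightarrow> x \<curlywedge> y = y \<curlywedge> x"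
    and join_comm: "\<lbrakk>x \<in> carrier A; y \<in> carrier A\<rbrakk> \<Longrightarrow> x \<curlyvee> y = y \<curlyvee> x"
    and meet_assoc: "\<lbrakk>x \<in> carrier A; y \<in> carrier A; z \<in> carrier A\<rbrakk>
      \<Longrightarrow> (x \<curlywedge> y) \<curlywedge> z = x \<curlywedge> (y \<curlywedge> z)"
    and join_assoc: "\<lbrakk>x \<in> carrier A; y \<in> carrier A; z \<in> carrier A\<rbrakk>
      \<Longrightarrow> (x \<curlyvee> y) \<curlyvee> z = x \<curlyvee> (y \<curlyvee> z)"
    and meet_join_absorb: "\<lbrakk>x \<in> carrier A; y \<in> carrier A\<rbrakk> \<Longrightarrow> x \<curlywedge> (x \<curlyvee> y) = x"
    and join_meet_absorb: "\<lbrakk>x \<in> carrier A; y \<in> carrier A\<rbrakk> \<Longrightarrow> x \<curlyvee> (x \<curlywedge> y) = x"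
    and mult_idem: "x \<in> carrier A \<Longrightarrow> x \<otimes> x = x"
    and residuation: "\<lbrakk>x \<in> carrier A; y \<in> carrier A; z \<in> carrier A\<rbrakk>
      \<Longrightarrow> x \<otimes> y \<preceq> z \<longleftrightarrow> y \<preceq> x \<leadsto> z"
    and neg_neg: "x \<in> carrier A \<Longrightarrow> \<sim> (\<sim> x) = x"

definition CIdInRL :: "'a rl_algebra set"
  where "CIdInRL = {A. cidinrl A}"

inductive_set rl_generate :: "('a, 'b) rl_algebra_scheme \<Rightarrow> 'a set \<Rightarrow> 'a set"
  for A (structure) and X where
  gen: "x \<in> X \<Longrightarrow> x \<in> rl_generate A X"
| one: "\<one> \<in> rl_generate A X"
| zero: "\<zero> \<in> rl_generate A X"
| mult: "\<lbrakk>x \<in> rl_generate A X; y \<in> rl_generate A X\<rbrakk> \<Longrightarrow> x \<otimes> y \<in> rl_generate A X"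
| meet: "\<lbrakk>x \<in> rl_generate A X; y \<in> rl_generate A X\<rbrakk> \<Longrightarrow> x \<curlywedge> y \<in> rl_generate A X"
| join: "\<lbrakk>x \<in> rl_generate A X; y \<in> rl_generate A X\<rbrakk> \<Longrightarrow> x \<curlyvee> y \<in> rl_generate A X"
| imp: "\<lbrakk>x \<in> rl_generate A X; y \<in> rl_generate A X\<rbrakk> \<Longrightarrow> x \<leadsto> y \<in> rl_generate A X"

definition finitely_generated :: "('a, 'b) rl_algebra_scheme \<Rightarrow> bool"
  where "finitely_generated A \<longleftrightarrow>
    (\<exists>X. finite X \<and> X \<subseteq> carrier A \<and> rl_generate A X = carrier A)"

text \<open>
  A class of algebras is a set of records over one element type. Finitely generated algebras of
  this signature are countable, so each is isomorphic to one whose carrier is a set of natural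
  numbers: for a class closed under isomorphism, local finiteness at element type \<^typ>\<open>nat\<close>
  is local finiteness of the whole class.
\<close>

definition locally_finite :: "'a rl_algebra set \<Rightarrow> bool"
  where "locally_finite V \<longleftrightarrow> (\<forall>A\<in>V. finitely_generated A \<longrightarrow> finite (carrier A))"

end

theory Submission
  imports Defs "HOL-Library.Countable_Set" "HOL-Library.Product_Order"
begin

text \<open>
  For a subsemilattice \<open>D\<close> of a meet semilattice \<open>W\<close> with top, the sets closed under the Galois
  connection of the relation \<open>inf x y \<in> D\<close> form a member of the variety; idempotency of the
  multiplication is exactly what closure of \<open>D\<close> under meets provides. The negative cone
  of a member is a Brouwerian algebra with implication \<open>(x \<leadsto> y) \<curlywedge> \<one>\<close>. Choosing \<open>W\<close> and \<open>D\<close> suitably,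
  this negative cone contains the Heyting algebra of up-sets of the Rieger-Nishimura frame,
  which is finitely generated and infinite.
\<close>

subsection \<open>Transport along embeddings\<close>

text \<open>Apart from closure conditions, the axioms are equations, or for residuation an
  equivalence of two equations once \<open>rl_le\<close> is unfolded. Such conditions are inherited
  along an injective homomorphism.\<close>

lemma cidinrl_embedding:
  fixes A :: "('a, 'c) rl_algebra_scheme" and B :: "('b, 'd) rl_algebra_scheme"
  assumes "cidinrl A"
    and inj: "inj_on h (carrier B)"
    and h: "\<And>x. x \<in> carrier B \<Longrightarrow> h x \<in> carrier A"
    and one: "\<one>\<^bsub>B\<^esub> \<in> carrier B" "h \<one>\<^bsub>B\<^esub> = \<one>\<^bsub>A\<^esub>"
    and zero: "\<zero>\<^bsub>B\<^esub> \<in> carrier B" "h \<zero>\<^bsub>B\<^esub> = \<zero>\<^bsub>A\<^esub>"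
    and closed: "\<And>x y. \<lbrakk>x \<in> carrier B; y \<in> carrier B\<rbrakk> \<Longrightarrow> x \<otimes>\<^bsub>B\<^esub> y \<in> carrier B"
      "\<And>x y. \<lbrakk>x \<in> carrier B; y \<in> carrier B\<rbrakk> \<Longrightarrow> x \<curlywedge>\<^bsub>B\<^esub> y \<in> carrier B"
      "\<And>x y. \<lbrakk>x \<in> carrier B; y \<in> carrier B\<rbrakk> \<Longrightarrow> x \<curlyvee>\<^bsub>B\<^esub> y \<in> carrier B"
      "\<And>x y. \<lbrakk>x \<in> carrier B; y \<in> carrier B\<rbrakk> \<Longrightarrow> x \<leadsto>\<^bsub>B\<^esub> y \<in> carrier B"
    and hom: "\<And>x y. \<lbrakk>x \<in> carrier B; y \<in> carrier B\<rbrakk> \<Longrightarrow> h (x \<otimes>\<^bsub>B\<^esub> y) = h x \<otimes>\<^bsub>A\<^esub> h y"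
      "\<And>x y. \<lbrakk>x \<in> carrier B; y \<in> carrier B\<rbrakk> \<Longrightarrow> h (x \<curlywedge>\<^bsub>B\<^esub> y) = h x \<curlywedge>\<^bsub>A\<^esub> h y"
      "\<And>x y. \<lbrakk>x \<in> carrier B; y \<in> carrier B\<rbrakk> \<Longrightarrow> h (x \<curlyvee>\<^bsub>B\<^esub> y) = h x \<curlyvee>\<^bsub>A\<^esub> h y"
      "\<And>x y. \<lbrakk>x \<in> carrier B; y \<in> carrier B\<rbrakk> \<Longrightarrow> h (x \<leadsto>\<^bsub>B\<^esub> y) = h x \<leadsto>\<^bsub>A\<^esub> h y"
  shows "cidinrl B"
proof -
  interpret A: cidinrl A by fact
  have eq: "x = y \<longleftrightarrow> h x = h y" if "x \<in> carrier B" "y \<in> carrier B" for x y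
    using inj that by (auto dest: inj_onD)
  have le: "x \<preceq>\<^bsub>B\<^esub> y \<longleftrightarrow> h x \<preceq>\<^bsub>A\<^esub> h y" if "x \<in> carrier B" "y \<in> carrier B" for x y
    using that by (simp add: rl_le_def eq closed hom)
  have neg: "h (\<sim>\<^bsub>B\<^esub> x) = \<sim>\<^bsub>A\<^esub> (h x)" "\<sim>\<^bsub>B\<^esub> x \<in> carrier B" if "x \<in> carrier B" for x
    using that by (simp_all add: rl_neg_def closed hom zero)
  show ?thesis
  proof unfold_locales
    fix x y z assume "x \<in> carrier B" "y \<in> carrier B" "z \<in> carrier B"
    then show "x \<otimes>\<^bsub>B\<^esub> y \<preceq>\<^bsub>B\<^esub> z \<longleftrightarrow> y \<preceq>\<^bsub>B\<^esub> x \<leadsto>\<^bsub>B\<^esub> z"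
      by (simp add: le closed hom h A.residuation)
  next
    fix x y assume "x \<in> carrier B" "y \<in> carrier B"
    then show "x \<otimes>\<^bsub>B\<^esub> y = y \<otimes>\<^bsub>B\<^esub> x" "x \<curlywedge>\<^bsub>B\<^esub> y = y \<curlywedge>\<^bsub>B\<^esub> x" "x \<curlyvee>\<^bsub>B\<^esub> y = y \<curlyvee>\<^bsub>B\<^esub> x"
      by (simp_all add: eq closed hom h A.m_comm A.meet_comm A.join_comm)
  qed (simp_all add: eq one zero closed hom h neg A.neg_neg A.mult_idem A.m_assoc
      A.meet_assoc A.join_assoc A.meet_join_absorb A.join_meet_absorb)
qed

lemma (in cidinrl) rl_generate_closed:
  assumes "X \<subseteq> carrier A" "x \<in> rl_generate A X"
  shows "x \<in> carrier A"
  using assms(2,1)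
  by induction (auto simp: meet_closed join_closed imp_closed zero_closed)

text \<open>Terms form a countable type, and their values under an enumeration of the generators
  cover the generated subalgebra, which is therefore countable.\<close>

datatype rl_term = Var nat | One | Zero
  | Mult rl_term rl_term | Meet rl_term rl_term | Join rl_term rl_term | Imp rl_term rl_term

instance rl_term :: countable
  by countable_datatype

primrec rl_eval :: "('a, 'b) rl_algebra_scheme \<Rightarrow> (nat \<Rightarrow> 'a) \<Rightarrow> rl_term \<Rightarrow> 'a" where
  "rl_eval A v (Var n) = v n"
| "rl_eval A v One = \<one>\<^bsub>A\<^esub>"
| "rl_eval A v Zero = \<zero>\<^bsub>A\<^esub>"
| "rl_eval A v (Mult s t) = rl_eval A v s \<otimes>\<^bsub>A\<^esub> rl_eval A v t"
| "rl_eval A v (Meet s t) = rl_eval A v s \<curlywedge>\<^bsub>A\<^esub> rl_eval A v t"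
| "rl_eval A v (Join s t) = rl_eval A v s \<curlyvee>\<^bsub>A\<^esub> rl_eval A v t"
| "rl_eval A v (Imp s t) = rl_eval A v s \<leadsto>\<^bsub>A\<^esub> rl_eval A v t"

lemma countable_rl_generate:
  assumes "countable X"
  shows "countable (rl_generate A X)"
proof -
  \<comment> \<open>If \<open>X\<close> is empty, the values of \<open>v\<close> are unspecified;
    this is harmless, as the range only has to include the generated set.\<close>
  define v where "v = from_nat_into X"
  note eval = rangeI[of "rl_eval A v"]
  have "x \<in> range (rl_eval A v)" if "x \<in> rl_generate A X" for x
    using that
  proof induction
    case (gen x)
    then obtain n where "v n = x"
      using from_nat_into_surj[OF assms] unfolding v_def by blast
    then show ?case
      using eval[of "Var n"] by simp
  next
    case one
    show ?case using eval[of One] by simp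
  next
    case zero
    show ?case using eval[of Zero] by simp
  next
    case (mult x y)
    then obtain s t where "x = rl_eval A v s" "y = rl_eval A v t" by blast
    then show ?case using eval[of "Mult s t"] by simp
  next
    case (meet x y)
    then obtain s t where "x = rl_eval A v s" "y = rl_eval A v t" by blast
    then show ?case using eval[of "Meet s t"] by simp
  next
    case (join x y)
    then obtain s t where "x = rl_eval A v s" "y = rl_eval A v t" by blast
    then show ?case using eval[of "Join s t"] by simp
  next
    case (imp x y)
    then obtain s t where "x = rl_eval A v s" "y = rl_eval A v t" by blast
    then show ?case using eval[of "Imp s t"] by simp
  qed
  then have "rl_generate A X \<subseteq> range (rl_eval A v)" by blast
  then show ?thesis by (rule countable_subset) (rule countable_image[OF countableI_type])
qed

text \<open>The subalgebra generated by \<open>X\<close> is countably infinite, so its operations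
  can be copied along a bijection onto the natural numbers.\<close>

lemma not_locally_finite_nat:
  fixes A :: "('a, 'b) rl_algebra_scheme"
  assumes "cidinrl A" "finite X" "X \<subseteq> carrier A" "infinite (rl_generate A X)"
  shows "\<not> locally_finite (CIdInRL :: nat rl_algebra set)"
proof
  interpret A: cidinrl A by fact
  assume lf: "locally_finite (CIdInRL :: nat rl_algebra set)"
  define G where "G = rl_generate A X"
  define h where "h = from_nat_into G"
  define g where "g = to_nat_on G"
  have count: "countable G" "infinite G"
    using assms by (auto simp: G_def countable_finite intro: countable_rl_generate)
  have hG: "h n \<in> G" for n
    using count unfolding h_def by (metis from_nat_into finite.emptyI)
  have hg: "h (g x) = x" if "x \<in> G" for x
    using count that by (simp add: h_def g_def)
  have gh: "g (h n) = n" for n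
    using count by (simp add: h_def g_def)
  have GA: "x \<in> carrier A" if "x \<in> G" for x
    using that A.rl_generate_closed assms(3) by (auto simp: G_def)
  note intros = rl_generate.intros[where A = A and X = X, folded G_def]
  define B :: "nat rl_algebra" where
    "B = \<lparr>carrier = UNIV, mult = \<lambda>x y. g (h x \<otimes>\<^bsub>A\<^esub> h y), one = g \<one>\<^bsub>A\<^esub>,
      rl_meet = \<lambda>x y. g (h x \<curlywedge>\<^bsub>A\<^esub> h y), rl_join = \<lambda>x y. g (h x \<curlyvee>\<^bsub>A\<^esub> h y),
      rl_imp = \<lambda>x y. g (h x \<leadsto>\<^bsub>A\<^esub> h y), rl_zero = g \<zero>\<^bsub>A\<^esub>\<rparr>"
  have "cidinrl B"
    by (rule cidinrl_embedding[OF assms(1), of h])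
      (auto simp: B_def hG GA hg intros intro: inj_on_inverseI[of _ g] gh)
  moreover have "finitely_generated B"
  proof -
    \<comment> \<open>The bijection \<open>g\<close> carries generation from \<open>X\<close> in
      \<open>A\<close> to generation from its image in \<open>B\<close>; as \<open>g\<close> maps
      \<open>G\<close> onto all of \<open>nat\<close>, finitely many elements generate
      \<open>B\<close>.\<close>
    have "g x \<in> rl_generate B (g ` X)" if "x \<in> rl_generate A X" for x
      using that
    proof induction
      case (mult x y)
      then show ?case using rl_generate.mult[of "g x" B "g ` X" "g y"]
        by (simp add: B_def hg G_def)
    next
      case (meet x y)
      then show ?case using rl_generate.meet[of "g x" B "g ` X" "g y"]
        by (simp add: B_def hg G_def)
    next
      case (join x y)
      then show ?case using rl_generate.join[of "g x" B "g ` X" "g y"]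
        by (simp add: B_def hg G_def)
    next
      case (imp x y)
      then show ?case using rl_generate.imp[of "g x" B "g ` X" "g y"]
        by (simp add: B_def hg G_def)
    next
      case one
      show ?case using rl_generate.one[of B "g ` X"] by (simp add: B_def)
    next
      case zero
      show ?case using rl_generate.zero[of B "g ` X"] by (simp add: B_def)
    qed (auto intro: rl_generate.gen)
    then have "n \<in> rl_generate B (g ` X)" for n
      using hG[of n] gh[of n] by (metis G_def)
    then show ?thesis
      using assms(2) unfolding finitely_generated_def by (intro exI[of _ "g ` X"]) (auto simp: B_def)
  qed
  ultimately have "finite (carrier B)"
    using lf by (auto simp: locally_finite_def CIdInRL_def)
  then show False by (simp add: B_def)
qed

subsection \<open>Algebras of Galois-closed sets\<close>

definition perp :: "'w::bounded_lattice set \<Rightarrow> 'w set \<Rightarrow> 'w set"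
  where "perp D X = {w. \<forall>x\<in>X. inf w x \<in> D}"

definition meets :: "'w::bounded_lattice set \<Rightarrow> 'w set \<Rightarrow> 'w set"
  where "meets X Y = {inf x y |x y. x \<in> X \<and> y \<in> Y}"

text \<open>Girard's phase space for the monoid given by \<open>inf\<close> and \<open>top\<close>,
  with pole \<open>D\<close>. Unions and elementwise meets have to be closed; intersections and
  residuals of closed sets are closed already.\<close>

definition phase_algebra :: "'w::bounded_lattice set \<Rightarrow> 'w set rl_algebra"
  where "phase_algebra D =
    \<lparr>carrier = {X. perp D (perp D X) = X}, mult = \<lambda>X Y. perp D (perp D (meets X Y)), one = perp D D,
      rl_meet = (\<inter>), rl_join = \<lambda>X Y. perp D (perp D (X \<union> Y)),
      rl_imp = \<lambda>X Y. {w. \<forall>x\<in>X. inf w x \<in> Y}, rl_zero = D\<rparr>"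

lemma perp_extensive: "X \<subseteq> perp D (perp D X)"
  by (auto simp: perp_def inf_commute)

lemma perp_antimono: "X \<subseteq> Y \<Longrightarrow> perp D Y \<subseteq> perp D X"
  by (auto simp: perp_def)

lemma perp_perp_perp [simp]: "perp D (perp D (perp D X)) = perp D X"
  by (rule subset_antisym[OF perp_antimono[OF perp_extensive] perp_extensive])

lemma perp_Un: "perp D (X \<union> Y) = perp D X \<inter> perp D Y"
  by (auto simp: perp_def)

lemma perp_Un_closure: "perp D (perp D (perp D X) \<union> Y) = perp D (X \<union> Y)"
  by (simp add: perp_Un)

lemma perp_Un_closure': "perp D (Y \<union> perp D (perp D X)) = perp D (Y \<union> X)"
  by (simp add: perp_Un)

lemma perp_perp_least: "X \<subseteq> perp D Y \<Longrightarrow> perp D (perp D X) \<subseteq> perp D Y"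
  using perp_antimono[OF perp_antimono, of X "perp D Y" D D] by simp

text \<open>As \<open>top\<close> is the unit of \<open>inf\<close>, the pole is itself a perp, and
  \<open>perp D D\<close> is the closure of the singleton of \<open>top\<close>.\<close>

lemma perp_top: "perp D {top_class.top} = D"
  by (auto simp: perp_def)

lemma perp_perp_bot: "perp D (perp D D) = D"
  using perp_perp_perp[of D "{top_class.top}"] by (simp add: perp_top)

lemma meets_commute: "meets X Y = meets Y X"
  unfolding meets_def by (metis inf_commute)

lemma subset_meets_self: "X \<subseteq> meets X X"
proof
  fix x assume "x \<in> X"
  then have "inf x x \<in> meets X X" unfolding meets_def by blast
  then show "x \<in> meets X X" by simp
qed

lemma meets_assoc: "meets (meets X Y) Z = meets X (meets Y Z)"
proof -
  have "w \<in> meets (meets X Y) Z \<longleftrightarrow> w \<in> meets X (meets Y Z)" for w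
    unfolding meets_def by (auto simp: inf_assoc) (metis inf_assoc)+
  then show ?thesis by blast
qed

lemma meets_top: "meets {top_class.top} X = X"
  by (auto simp: meets_def)

text \<open>Currying. The right-hand side depends on \<open>X\<close> only through
  \<open>perp D X\<close>, so closing a factor does not change the perp of a product; associativity
  and the unit law of the multiplication rest on this.\<close>

lemma mem_perp_meets: "w \<in> perp D (meets X Y) \<longleftrightarrow> (\<forall>y\<in>Y. inf w y \<in> perp D X)"
proof -
  have "inf w (inf x y) = inf (inf w y) x" for x y
    by (simp add: ac_simps)
  moreover have "w \<in> perp D (meets X Y) \<longleftrightarrow> (\<forall>x\<in>X. \<forall>y\<in>Y. inf w (inf x y) \<in> D)"
    unfolding perp_def meets_def by blast
  ultimately show ?thesis
    by (auto simp: perp_def)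
qed

lemma perp_meets_closure: "perp D (meets (perp D (perp D X)) Y) = perp D (meets X Y)"
  by (auto simp: mem_perp_meets)

lemma perp_meets_closure': "perp D (meets Y (perp D (perp D X))) = perp D (meets Y X)"
  by (metis meets_commute perp_meets_closure)

lemma imp_eq_perp: "{w. \<forall>x\<in>X. inf w x \<in> perp D Y} = perp D (meets Y X)"
  by (auto simp: mem_perp_meets)

text \<open>One inclusion comes from \<open>inf x x = x\<close>. For the other,
  \<open>inf w (inf x y)\<close> is the meet of \<open>inf w x\<close> and \<open>inf w y\<close>,
  two elements of \<open>D\<close>.\<close>

lemma perp_meets_idem:
  assumes "\<And>x y. x \<in> D \<Longrightarrow> y \<in> D \<Longrightarrow> inf x y \<in> D"
  shows "perp D (meets X X) = perp D X"
proof
  show "perp D (meets X X) \<subseteq> perp D X"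
    by (intro perp_antimono subset_meets_self)
  show "perp D X \<subseteq> perp D (meets X X)"
  proof
    fix w assume w: "w \<in> perp D X"
    have "inf w (inf x y) \<in> D" if "x \<in> X" "y \<in> X" for x y
    proof -
      have "inf (inf w x) (inf w y) \<in> D"
        using w that assms by (auto simp: perp_def)
      then show ?thesis
        by (simp add: inf_assoc inf_left_commute)
    qed
    then show "w \<in> perp D (meets X X)"
      by (auto simp: perp_def meets_def)
  qed
qed

lemma cidinrl_phase_algebra:
  assumes D: "\<And>x y. x \<in> D \<Longrightarrow> y \<in> D \<Longrightarrow> inf x y \<in> D"
  shows "cidinrl (phase_algebra D)"
proof -
  let ?c = "\<lambda>X. perp D (perp D X)"
  \<comment> \<open>Writing the closed set \<open>Y\<close> as the perp of \<open>perp D Y\<close>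
    presents the residual as a perp, hence as a closed set.\<close>
  have imp: "{w. \<forall>x\<in>X. inf w x \<in> Y} = perp D (meets (perp D Y) X)" if "?c Y = Y" for X Y
    using imp_eq_perp[of X D "perp D Y"] that by simp
  have neg: "\<sim>\<^bsub>phase_algebra D\<^esub> X = perp D X" for X
    by (simp add: rl_neg_def phase_algebra_def perp_def)
  \<comment> \<open>Reduces residuation to the inclusion of the unclosed product
    \<open>meets X Y\<close> in \<open>Z\<close>.\<close>
  have least: "?c X \<subseteq> Y \<longleftrightarrow> X \<subseteq> Y" if "?c Y = Y" for X Y
    using that perp_perp_least[of X D "perp D Y"] perp_extensive[of X D] by auto
  show ?thesis
  proof unfold_locales
    fix X Y Z
    assume "X \<in> carrier (phase_algebra D)" "Y \<in> carrier (phase_algebra D)"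
      "Z \<in> carrier (phase_algebra D)"
    then have c: "?c X = X" "?c Y = Y" "?c Z = Z"
      by (simp_all add: phase_algebra_def)
    show "X \<otimes>\<^bsub>phase_algebra D\<^esub> Y \<otimes>\<^bsub>phase_algebra D\<^esub> Z
        = X \<otimes>\<^bsub>phase_algebra D\<^esub> (Y \<otimes>\<^bsub>phase_algebra D\<^esub> Z)"
      by (simp add: phase_algebra_def perp_meets_closure perp_meets_closure' meets_assoc)
    show "X \<curlyvee>\<^bsub>phase_algebra D\<^esub> Y \<curlyvee>\<^bsub>phase_algebra D\<^esub> Z
        = X \<curlyvee>\<^bsub>phase_algebra D\<^esub> (Y \<curlyvee>\<^bsub>phase_algebra D\<^esub> Z)"
      by (simp add: phase_algebra_def perp_Un_closure perp_Un_closure' Un_assoc)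
    show "X \<curlywedge>\<^bsub>phase_algebra D\<^esub> Y \<curlywedge>\<^bsub>phase_algebra D\<^esub> Z
        = X \<curlywedge>\<^bsub>phase_algebra D\<^esub> (Y \<curlywedge>\<^bsub>phase_algebra D\<^esub> Z)"
      by (simp add: phase_algebra_def Int_assoc)
    have "meets X Y \<subseteq> Z \<longleftrightarrow> (\<forall>y\<in>Y. \<forall>x\<in>X. inf y x \<in> Z)"
      unfolding meets_def subset_iff by simp (metis inf_commute)
    then show "X \<otimes>\<^bsub>phase_algebra D\<^esub> Y \<preceq>\<^bsub>phase_algebra D\<^esub> Z
        \<longleftrightarrow> Y \<preceq>\<^bsub>phase_algebra D\<^esub> X \<leadsto>\<^bsub>phase_algebra D\<^esub> Z"
      using least[OF c(3), of "meets X Y"]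
      by (auto simp: rl_le_def phase_algebra_def)
  next
    fix X Y
    assume "X \<in> carrier (phase_algebra D)" "Y \<in> carrier (phase_algebra D)"
    then have c: "?c X = X" "?c Y = Y"
      by (simp_all add: phase_algebra_def)
    \<comment> \<open>The intersection is the perp of
      \<open>perp D X \<union> perp D Y\<close>.\<close>
    show "X \<curlywedge>\<^bsub>phase_algebra D\<^esub> Y \<in> carrier (phase_algebra D)"
      using c perp_Un[of D "perp D X" "perp D Y"] perp_perp_perp[of D "perp D X \<union> perp D Y"]
      by (simp add: phase_algebra_def)
    show "X \<leadsto>\<^bsub>phase_algebra D\<^esub> Y \<in> carrier (phase_algebra D)"
      using c by (simp add: phase_algebra_def imp)
    show "X \<curlywedge>\<^bsub>phase_algebra D\<^esub> (X \<curlyvee>\<^bsub>phase_algebra D\<^esub> Y) = X"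
      using perp_extensive[of "X \<union> Y" D] by (auto simp: phase_algebra_def)
    show "X \<curlyvee>\<^bsub>phase_algebra D\<^esub> (X \<curlywedge>\<^bsub>phase_algebra D\<^esub> Y) = X"
      using c by (simp add: phase_algebra_def Un_absorb2)
    \<comment> \<open>The unit is the closure of the singleton of \<open>top\<close>, and that
      closure may be dropped inside the product.\<close>
    show "\<one>\<^bsub>phase_algebra D\<^esub> \<otimes>\<^bsub>phase_algebra D\<^esub> X = X"
      using c perp_meets_closure[of D "{top_class.top}" X]
      by (simp add: phase_algebra_def perp_top meets_top)
    then show "X \<otimes>\<^bsub>phase_algebra D\<^esub> \<one>\<^bsub>phase_algebra D\<^esub> = X"
      by (simp add: phase_algebra_def meets_commute)
    show "X \<otimes>\<^bsub>phase_algebra D\<^esub> X = X"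
      using c D by (simp add: phase_algebra_def perp_meets_idem)
    show "\<sim>\<^bsub>phase_algebra D\<^esub> (\<sim>\<^bsub>phase_algebra D\<^esub> X) = X"
      using c by (simp add: neg)
    show "X \<otimes>\<^bsub>phase_algebra D\<^esub> Y = Y \<otimes>\<^bsub>phase_algebra D\<^esub> X"
      by (simp add: phase_algebra_def meets_commute[of X])
    show "X \<curlyvee>\<^bsub>phase_algebra D\<^esub> Y = Y \<curlyvee>\<^bsub>phase_algebra D\<^esub> X"
      by (simp add: phase_algebra_def Un_commute)
    show "X \<curlywedge>\<^bsub>phase_algebra D\<^esub> Y = Y \<curlywedge>\<^bsub>phase_algebra D\<^esub> X"
      by (simp add: phase_algebra_def Int_commute)
  qed (simp_all add: phase_algebra_def perp_perp_bot)
qed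

subsection \<open>The Rieger-Nishimura frame\<close>

text \<open>
  The frame has the natural numbers as points, and \<open>n\<close> sees \<open>m\<close> iff \<open>m = n\<close> or \<open>m + 2 \<le> n\<close>.
  The up-sets are the fixed points of \<open>box\<close>. Taking \<open>ladder_bot\<close> as \<open>D\<close> gives \<open>\<one> = \<zero>\<close>, and \<open>emb\<close>
  embeds the Heyting algebra of up-sets into the negative cone. With \<open>A n = {..<n}\<close> and
  \<open>B n = insert (Suc n) {..<n}\<close>, all up-sets \<open>A (Suc n)\<close> arise from \<open>A 1\<close> and \<open>B 0\<close> through
  \<open>A (n + 2) = A (n + 1) \<union> B n\<close> and \<open>B (n + 1) = (B n \<Rightarrow> A (n + 1))\<close>.
\<close>

definition box :: "nat set \<Rightarrow> nat set"
  where "box c = {n. n \<in> c \<and> (\<forall>m. m + 2 \<le> n \<longrightarrow> m \<in> c)}"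

text \<open>Membership reads as a sequent: the interior of \<open>c\<close> entails
  \<open>d\<close>. In the second component, \<open>(UNIV, b)\<close> can thus bound
  \<open>box c\<close> by \<open>b\<close>.\<close>

definition ladder_bot :: "(nat set \<times> nat set) set"
  where "ladder_bot = {(c, d). box c \<subseteq> d}"

definition emb :: "nat set \<Rightarrow> (nat set \<times> nat set) set"
  where "emb b = {(c, d). box c \<subseteq> b \<inter> d}"

lemma box_Int: "box (c \<inter> d) = box c \<inter> box d"
  by (auto simp: box_def)

lemma box_subset: "box c \<subseteq> c"
  by (auto simp: box_def)

lemma box_box: "box (box c) = box c"
  by (auto simp: box_def)

lemma box_mono: "c \<subseteq> d \<Longrightarrow> box c \<subseteq> box d"
  by (auto simp: box_def)

lemma inf_ladder_bot: "x \<in> ladder_bot \<Longrightarrow> y \<in> ladder_bot \<Longrightarrow> inf x y \<in> ladder_bot"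
  by (cases x; cases y) (auto simp: ladder_bot_def box_Int subset_iff)

text \<open>One inclusion holds because \<open>top\<close> lies in \<open>ladder_bot\<close>, the
  other because \<open>ladder_bot\<close> is closed under meets.\<close>

lemma perp_ladder_bot: "perp ladder_bot ladder_bot = ladder_bot"
proof
  show "perp ladder_bot ladder_bot \<subseteq> ladder_bot"
  proof
    fix w assume "w \<in> perp ladder_bot ladder_bot"
    moreover have "top_class.top \<in> ladder_bot" by (simp add: ladder_bot_def top_prod_def)
    ultimately have "inf w top_class.top \<in> ladder_bot" unfolding perp_def by blast
    then show "w \<in> ladder_bot" by simp
  qed
  show "ladder_bot \<subseteq> perp ladder_bot ladder_bot"
    unfolding perp_def using inf_ladder_bot by blast
qed

section \<open>Up-sets inside the negative cone\<close>

lemma emb_eq_perp: "emb b = perp ladder_bot {(UNIV, b)}"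
  by (auto simp: emb_def perp_def ladder_bot_def)

text \<open>The pair \<open>(b, b)\<close> is the critical test: the condition it imposes already
  implies those of all other members of \<open>emb b\<close>.\<close>

lemma perp_emb:
  assumes "box b = b"
  shows "perp ladder_bot (emb b) = {(x, y). b \<inter> box x \<subseteq> y}"
proof -
  have "(b, b) \<in> emb b" using assms by (simp add: emb_def)
  then show ?thesis
    using assms by (fastforce simp: perp_def emb_def ladder_bot_def box_Int)
qed

text \<open>A join is a double perp, so it suffices to compare perps. There the conditions for
  \<open>a\<close> and \<open>b\<close> together say that
  \<open>(a \<union> b) \<inter> box x\<close> lies in \<open>y\<close>.\<close>

lemma emb_join:
  assumes "box a = a" "box b = b" "box (a \<union> b) = a \<union> b"
  shows "emb a \<curlyvee>\<^bsub>phase_algebra ladder_bot\<^esub> emb b = emb (a \<union> b)"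
proof -
  have "perp ladder_bot (emb a \<union> emb b) = perp ladder_bot (emb (a \<union> b))"
    using assms by (auto simp: perp_Un perp_emb)
  then show ?thesis
    by (simp add: phase_algebra_def emb_eq_perp)
qed

text \<open>The set \<open>box (- a \<union> b)\<close> is the Heyting implication of up-sets when
  \<open>b\<close> is one too. Testing against \<open>(a, a)\<close> gives
  \<open>a \<inter> box c \<subseteq> b\<close>, and the meet with the unit supplies
  \<open>box c \<subseteq> d\<close>.\<close>

lemma emb_imp:
  assumes "box a = a"
  shows "(emb a \<leadsto>\<^bsub>phase_algebra ladder_bot\<^esub> emb b) \<curlywedge>\<^bsub>phase_algebra ladder_bot\<^esub>
    \<one>\<^bsub>phase_algebra ladder_bot\<^esub> = emb (box (- a \<union> b))"
proof -
  have "(a, a) \<in> emb a" using assms by (simp add: emb_def)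
  then have *: "(\<forall>x\<in>emb a. inf (c, d) x \<in> emb b) \<and> box c \<subseteq> d \<longleftrightarrow> a \<inter> box c \<subseteq> b \<and> box c \<subseteq> d" for c d
    using assms by (fastforce simp: emb_def box_Int)
  \<comment> \<open>Heyting residuation: \<open>box\<close> yields the largest up-set inside a set,
    and \<open>box c\<close> is an up-set.\<close>
  have **: "a \<inter> box c \<subseteq> b \<longleftrightarrow> box c \<subseteq> box (- a \<union> b)" for c
    using box_mono[of "box c" "- a \<union> b"] box_subset[of "- a \<union> b"] box_box[of c] by blast
  have "{w. \<forall>x\<in>emb a. inf w x \<in> emb b} \<inter> ladder_bot = emb (box (- a \<union> b))"
  proof (rule Set.set_eqI)
    fix w :: "nat set \<times> nat set"
    obtain c d where w: "w = (c, d)" by (cases w)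
    have "w \<in> ladder_bot \<longleftrightarrow> box c \<subseteq> d"
      by (simp add: w ladder_bot_def)
    moreover have "w \<in> emb (box (- a \<union> b)) \<longleftrightarrow> box c \<subseteq> box (- a \<union> b) \<and> box c \<subseteq> d"
      by (simp add: w emb_def box_box)
    ultimately show "w \<in> {w. \<forall>x\<in>emb a. inf w x \<in> emb b} \<inter> ladder_bot \<longleftrightarrow> w \<in> emb (box (- a \<union> b))"
      using *[of c d] **[of c] unfolding w by blast
  qed
  then show ?thesis
    by (simp add: phase_algebra_def perp_ladder_bot)
qed

text \<open>The pair \<open>(a, UNIV)\<close> recovers the order: it lies in \<open>emb b\<close>
  exactly when the up-set \<open>a\<close> is contained in \<open>b\<close>.\<close>

lemma inj_on_emb: "inj_on emb {b. box b = b}"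
proof (rule inj_onI)
  have "a \<subseteq> b" if "box a = a" "emb a = emb b" for a b
  proof -
    have "(a, UNIV) \<in> emb a" using that(1) by (simp add: emb_def)
    then have "(a, UNIV) \<in> emb b" using that by simp
    then show ?thesis using that(1) by (simp add: emb_def)
  qed
  then show "a = b" if "a \<in> {b. box b = b}" "b \<in> {b. box b = b}" "emb a = emb b" for a b
    using that by (simp add: subset_antisym)
qed

section \<open>Generating the ladder\<close>

lemma box_lessThan: "box {..<n} = {..<n}"
  by (auto simp: box_def)

lemma box_insert_lessThan: "box (insert (Suc n) {..<n}) = insert (Suc n) {..<n}"
  by (auto simp: box_def)

text \<open>The set under \<open>box\<close> misses only the point \<open>Suc n\<close>, so
  \<open>box\<close> removes exactly the points that see it: \<open>Suc n\<close> itself and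
  everything from \<open>n + 3\<close> on. The point \<open>n + 2\<close> survives.\<close>

lemma box_imp_ladder:
  "box (- insert (Suc n) {..<n} \<union> {..<Suc n}) = insert (Suc (Suc n)) {..<Suc n}"
proof (rule Set.set_eqI)
  fix k
  have "k \<in> box (- insert (Suc n) {..<n} \<union> {..<Suc n}) \<longleftrightarrow> k \<noteq> Suc n \<and> \<not> Suc n + 2 \<le> k"
    by (auto simp: box_def)
  also have "\<dots> \<longleftrightarrow> k \<in> insert (Suc (Suc n)) {..<Suc n}"
    by auto
  finally show "k \<in> box (- insert (Suc n) {..<n} \<union> {..<Suc n}) \<longleftrightarrow> k \<in> insert (Suc (Suc n)) {..<Suc n}" .
qed

text \<open>The two sequences are treated in one induction because the next member of each is
  computed from the current members of both.\<close>

lemma emb_ladder_generated: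
  fixes n :: nat
  defines "G \<equiv> rl_generate (phase_algebra ladder_bot) {emb {0}, emb {1}}"
  shows "emb {..<Suc n} \<in> G \<and> emb (insert (Suc n) {..<n}) \<in> G"
proof (induction n)
  case 0
  have "{..<Suc 0} = {0}" "insert (Suc 0) {..<0} = {1}" by auto
  then show ?case by (auto simp: G_def intro: rl_generate.gen)
next
  case (Suc n)
  have un: "{..<Suc n} \<union> insert (Suc n) {..<n} = {..<Suc (Suc n)}"
    by auto
  have IH: "emb {..<Suc n} \<in> G" "emb (insert (Suc n) {..<n}) \<in> G"
    using Suc by auto
  have "emb {..<Suc n} \<curlyvee>\<^bsub>phase_algebra ladder_bot\<^esub> emb (insert (Suc n) {..<n}) = emb {..<Suc (Suc n)}"
    using emb_join[OF box_lessThan box_insert_lessThan, of "Suc n" n]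
    by (simp only: un box_lessThan)
  then have "emb {..<Suc (Suc n)} \<in> G"
    using rl_generate.join[OF IH[unfolded G_def]] by (simp add: G_def)
  moreover have "(emb (insert (Suc n) {..<n}) \<leadsto>\<^bsub>phase_algebra ladder_bot\<^esub> emb {..<Suc n})
      \<curlywedge>\<^bsub>phase_algebra ladder_bot\<^esub> \<one>\<^bsub>phase_algebra ladder_bot\<^esub> = emb (insert (Suc (Suc n)) {..<Suc n})"
    using emb_imp[OF box_insert_lessThan] by (simp only: box_imp_ladder)
  then have "emb (insert (Suc (Suc n)) {..<Suc n}) \<in> G"
    using rl_generate.meet[OF rl_generate.imp[OF IH(2,1)[unfolded G_def]] rl_generate.one]
    by (simp add: G_def)
  ultimately show ?case ..
qed

theorem proposition7p3: "\<not> locally_finite (CIdInRL :: nat rl_algebra set)"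
proof (rule not_locally_finite_nat)
  show "cidinrl (phase_algebra ladder_bot)"
    using inf_ladder_bot by (rule cidinrl_phase_algebra)
  show "{emb {0}, emb {1}} \<subseteq> carrier (phase_algebra ladder_bot)"
    by (simp add: phase_algebra_def emb_eq_perp)
  \<comment> \<open>Initial segments are distinct up-sets, so their images are infinitely many
    distinct generated elements.\<close>
  have "inj (\<lambda>n. emb {..<Suc n})"
  proof (rule injI)
    fix m n :: nat assume "emb {..<Suc m} = emb {..<Suc n}"
    then have "{..<Suc m} = {..<Suc n}"
      by (rule inj_onD[OF inj_on_emb]) (simp_all only: box_lessThan mem_Collect_eq)
    then show "m = n" by (simp only: lessThan_eq_iff nat.inject)
  qed
  moreover have "range (\<lambda>n. emb {..<Suc n})
      \<subseteq> rl_generate (phase_algebra ladder_bot) {emb {0}, emb {1}}"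
    using emb_ladder_generated by auto
  ultimately show "infinite (rl_generate (phase_algebra ladder_bot) {emb {0}, emb {1}})"
    using infinite_super range_inj_infinite by blast
qed simp

end
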